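(* Let $\mathsf{CS}$ be any constant specification for $\mathsf{LPLTL}^{\mathsf P}$. For every formula $\phi$ and every finite set of formulas $\Gamma$: if $\Gamma\vdash_{\mathsf{CS}}\phi$, then $\Gamma\models_{\mathsf{CS}}\phi$.
   Context: Language. Fix $h\ge 1$ agents $\mathsf{Ag}=\{1,\dots,h\}$ and countable sets of justification constants, justification variables, and atomic propositions $\mathsf{Prop}$. Terms: $t::=c\mid x\mid\ !t\mid t+t\mid t\cdot t$ ($c$ a constant, $x$ a variable). Formulas: $\phi::=P\mid\bot\mid\phi\to\phi\mid\bigcirc\phi\mid\mathsf{Y}_w\phi\mid\phi\,\mathcal{U}\,\phi\mid\phi\,\mathcal{S}\,\phi\mid[t]_i\phi$ with $P\in\mathsf{Prop}$, $i\in\mathsf{Ag}$ ($\bigcirc$ = next, $\mathsf{Y}_w$ = weak previous, $\mathcal U$ = until, $\mathcal S$ = since). Abbreviations: $\neg\phi:=\phi\to\bot$, $\top:=\neg\bot$, usual $\lor,\land,\leftrightarrow$; $\mathsf{Y}_s\phi:=\neg\mathsf{Y}_w\neg\phi$; $\Diamond\phi:=\top\,\mathcal U\,\phi$; $\Box\phi:=\neg\Diamond\neg\phi$; $\Diamond^{-}\phi:=\top\,\mathcal S\,\phi$; $\boxminus\phi:=\neg\Diamond^{-}\neg\phi$. The system $\mathsf{LPLTL}^{\mathsf P}$. Axioms: all propositional tautologies; $\bigcirc(\phi\to\psi)\to(\bigcirc\phi\to\bigcirc\psi)$; $\Box(\phi\to\psi)\to(\Box\phi\to\Box\psi)$; $\bigcirc\neg\phi\leftrightarrow\neg\bigcirc\phi$;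 $\Box(\phi\to\bigcirc\phi)\to(\phi\to\Box\phi)$; $\phi\,\mathcal U\,\psi\to\Diamond\psi$; $\phi\,\mathcal U\,\psi\leftrightarrow\psi\lor(\phi\land\bigcirc(\phi\,\mathcal U\,\psi))$; $\boxminus(\phi\to\psi)\to(\boxminus\phi\to\boxminus\psi)$; $\mathsf Y_w(\phi\to\psi)\to(\mathsf Y_w\phi\to\mathsf Y_w\psi)$; $\mathsf Y_s\phi\to\mathsf Y_w\phi$; $\phi\to\bigcirc\mathsf Y_s\phi$; $\phi\to\mathsf Y_w\bigcirc\phi$; $\Diamond^{-}\mathsf Y_w\bot$; $\boxminus(\phi\to\mathsf Y_w\phi)\to(\phi\to\boxminus\phi)$; $\phi\,\mathcal S\,\psi\to\Diamond^{-}\psi$; $\phi\,\mathcal S\,\psi\leftrightarrow\psi\lor(\phi\land\mathsf Y_s(\phi\,\mathcal S\,\psi))$; and for all agents $i$, terms $s,t$: $[t]_i(\phi\to\psi)\to([s]_i\phi\to[t\cdot s]_i\psi)$; $[t]_i\phi\to[t+s]_i\phi$ and $[s]_i\phi\to[t+s]_i\phi$; $[t]_i\phi\to\phi$; $[t]_i\phi\to[!t]_i[t]_i\phi$. A constant specification $\mathsf{CS}$ is a set of formulas $[c_n]_{i_n}\cdots[c_1]_{i_1}\phi$ ($n\ge1$, $c_k$ constants, $i_k$ agents, $\phi$ an axiom instance) which is downward closed: if $[c_n]_{i_n}[c_{n-1}]_{i_{n-1}}\cdots[c_1]_{i_1}\phi\in\mathsf{CS}$ with $n>1$ then $[c_{n-1}]_{i_{n-1}}\cdots[c_1]_{i_1}\phi\in\mathsf{CS}$.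 Rules: modus ponens; from $\vdash\phi$ infer each of $\vdash\bigcirc\phi$, $\vdash\mathsf Y_w\phi$, $\vdash\Box\phi$, $\vdash\boxminus\phi$; and $\vdash\psi$ for every $\psi\in\mathsf{CS}$. $\vdash_{\mathsf{CS}}\phi$ means $\phi$ is derivable. For a set $\Gamma$, $\Gamma\vdash_{\mathsf{CS}}\phi$ holds iff there are $\psi_1,\dots,\psi_n\in\Gamma$ with $\vdash_{\mathsf{CS}}(\psi_1\land\dots\land\psi_n)\to\phi$. Interpreted systems. A frame $(S,R_1,\dots,R_h)$ has a nonempty set $S$ and reflexive transitive relations $R_i\subseteq S\times S$. A run is a map $r:\mathbb N\to S$; a system $\mathcal R$ is a nonempty set of runs. A $\mathsf{CS}$-evidence function for agent $i$ is $\mathcal E_i:S\times\mathsf{Tm}\to\mathcal P(\mathsf{Fml})$ such that for all $s,t,\phi,\psi,v,w$: if $R_i(v,w)$ then $\mathcal E_i(v,t)\subseteq\mathcal E_i(w,t)$; if $[t]_i\phi\in\mathsf{CS}$ then $\phi\in\mathcal E_i(w,t)$; if $\phi\to\psi\in\mathcal E_i(w,t)$ and $\phi\in\mathcal E_i(w,s)$ then $\psi\in\mathcal E_i(w,t\cdot s)$; $\mathcal E_i(w,s)\cup\mathcal E_i(w,t)\subseteq\mathcal E_i(w,s+t)$; if $\phi\in\mathcal E_i(w,t)$ then $[t]_i\phi\in\mathcal E_i(w,!t)$. An interpreted system for $\mathsf{CS}$ is $\mathcal I=(\mathcal R,S,R_1,\dots,R_h,\mathcal E_1,\dots,\mathcal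 E_h,\nu)$ with $\mathcal R$ a system on the frame, $\mathcal E_i$ such evidence functions, $\nu:S\to\mathcal P(\mathsf{Prop})$. Truth at a point $(r,n)$, $r\in\mathcal R$: $P$ iff $P\in\nu(r(n))$; $\bot$ never; $\to$ classically; $\mathsf Y_w\phi$ iff $n=0$ or $\phi$ holds at $(r,n-1)$; $\bigcirc\phi$ iff $\phi$ holds at $(r,n+1)$; $\phi\,\mathcal S\,\psi$ iff some $m\le n$ has $\psi$ at $(r,m)$ and $\phi$ at $(r,k)$ for all $m<k\le n$; $\phi\,\mathcal U\,\psi$ iff some $m\ge n$ has $\psi$ at $(r,m)$ and $\phi$ at $(r,k)$ for all $n\le k<m$; $[t]_i\phi$ iff $\phi\in\mathcal E_i(r(n),t)$ and $\phi$ holds at $(r',n')$ for all $r'\in\mathcal R$, $n'\in\mathbb N$ with $R_i(r(n),r'(n'))$. $\Gamma\models_{\mathsf{CS}}\phi$ means: for every interpreted system $\mathcal I$ for $\mathsf{CS}$, every run $r$ of it and every $n$, if all formulas of $\Gamma$ hold at $(r,n)$ then $\phi$ holds at $(r,n)$. *)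

theory Defs
  imports Main "HOL-Library.Countable"
begin

section \<open>Language\<close>

text \<open>
  The type variables stand for atomic propositions \<open>'p\<close>, justification constants \<open>'c\<close>,
  justification variables \<open>'x\<close> and agents \<open>'ag\<close>. Statements about the logic constrain the first
  three to class \<open>countable\<close> and the last to class \<open>finite\<close>, so that the agents are
  \<open>{1, \<dots>, h}\<close> with \<open>h = CARD('ag) \<ge> 1\<close>.
\<close>

datatype ('c, 'x) tm =
    Const 'c
  | Var 'x
  | Bang "('c, 'x) tm"
  | Plus "('c, 'x) tm" "('c, 'x) tm"
  | App "('c, 'x) tm" "('c, 'x) tm"

datatype ('p, 'c, 'x, 'ag) fml =
    Atom 'p
  | Fls
  | Imp "('p, 'c, 'x, 'ag) fml" "('p, 'c, 'x, 'ag) fml"  (infixr \<open>\<^bold>\<longrightarrow>\<close> 55)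
  | Next "('p, 'c, 'x, 'ag) fml"
  | WPrev "('p, 'c, 'x, 'ag) fml"
  | Until "('p, 'c, 'x, 'ag) fml" "('p, 'c, 'x, 'ag) fml"  (infix \<open>\<^bold>U\<close> 65)
  | Since "('p, 'c, 'x, 'ag) fml" "('p, 'c, 'x, 'ag) fml"  (infix \<open>\<^bold>S\<close> 65)
  | Just "('c, 'x) tm" 'ag "('p, 'c, 'x, 'ag) fml"

abbreviation Neg :: "('p, 'c, 'x, 'ag) fml \<Rightarrow> ('p, 'c, 'x, 'ag) fml" where
  "Neg \<phi> \<equiv> \<phi> \<^bold>\<longrightarrow> Fls"

abbreviation Tru :: "('p, 'c, 'x, 'ag) fml" where
  "Tru \<equiv> Neg Fls"

abbreviation Disj :: "('p, 'c, 'x, 'ag) fml \<Rightarrow> ('p, 'c, 'x, 'ag) fml \<Rightarrow> ('p, 'c, 'x, 'ag) fml"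
    (infixr \<open>\<^bold>\<or>\<close> 58) where
  "\<phi> \<^bold>\<or> \<psi> \<equiv> Neg \<phi> \<^bold>\<longrightarrow> \<psi>"

abbreviation Conj :: "('p, 'c, 'x, 'ag) fml \<Rightarrow> ('p, 'c, 'x, 'ag) fml \<Rightarrow> ('p, 'c, 'x, 'ag) fml"
    (infixr \<open>\<^bold>\<and>\<close> 60) where
  "\<phi> \<^bold>\<and> \<psi> \<equiv> Neg (\<phi> \<^bold>\<longrightarrow> Neg \<psi>)"

abbreviation Iff :: "('p, 'c, 'x, 'ag) fml \<Rightarrow> ('p, 'c, 'x, 'ag) fml \<Rightarrow> ('p, 'c, 'x, 'ag) fml"
    (infix \<open>\<^bold>\<longleftrightarrow>\<close> 53) where
  "\<phi> \<^bold>\<longleftrightarrow> \<psi> \<equiv> (\<phi> \<^bold>\<longrightarrow> \<psi>) \<^bold>\<and> (\<psi> \<^bold>\<longrightarrow> \<phi>)"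

abbreviation SPrev :: "('p, 'c, 'x, 'ag) fml \<Rightarrow> ('p, 'c, 'x, 'ag) fml" where
  "SPrev \<phi> \<equiv> Neg (WPrev (Neg \<phi>))"

abbreviation Eventually :: "('p, 'c, 'x, 'ag) fml \<Rightarrow> ('p, 'c, 'x, 'ag) fml" where
  "Eventually \<phi> \<equiv> Tru \<^bold>U \<phi>"

abbreviation Always :: "('p, 'c, 'x, 'ag) fml \<Rightarrow> ('p, 'c, 'x, 'ag) fml" where
  "Always \<phi> \<equiv> Neg (Eventually (Neg \<phi>))"

abbreviation Once :: "('p, 'c, 'x, 'ag) fml \<Rightarrow> ('p, 'c, 'x, 'ag) fml" where
  "Once \<phi> \<equiv> Tru \<^bold>S \<phi>"

abbreviation Historically :: "('p, 'c, 'x, 'ag) fml \<Rightarrow> ('p, 'c, 'x, 'ag) fml" where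
  "Historically \<phi> \<equiv> Neg (Once (Neg \<phi>))"

fun Conjs :: "('p, 'c, 'x, 'ag) fml list \<Rightarrow> ('p, 'c, 'x, 'ag) fml" where
  "Conjs [] = Tru"
| "Conjs [\<phi>] = \<phi>"
| "Conjs (\<phi> # \<psi> # \<psi>s) = \<phi> \<^bold>\<and> Conjs (\<psi> # \<psi>s)"


section \<open>Proof system\<close>

text \<open>
  A formula is a propositional tautology if it is true under every truth assignment to its
  maximal subformulas not of the form \<open>\<bottom>\<close> or \<open>\<phi> \<rightarrow> \<psi>\<close>; these are exactly the substitution
  instances of the tautologies of classical propositional logic.
\<close>

fun peval :: "(('p, 'c, 'x, 'ag) fml \<Rightarrow> bool) \<Rightarrow> ('p, 'c, 'x, 'ag) fml \<Rightarrow> bool" where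
  "peval v Fls \<longleftrightarrow> False"
| "peval v (\<phi> \<^bold>\<longrightarrow> \<psi>) \<longleftrightarrow> (peval v \<phi> \<longrightarrow> peval v \<psi>)"
| "peval v \<phi> \<longleftrightarrow> v \<phi>"

definition tautology :: "('p, 'c, 'x, 'ag) fml \<Rightarrow> bool" where
  "tautology \<phi> \<longleftrightarrow> (\<forall>v. peval v \<phi>)"

inductive axiom_inst :: "('p, 'c, 'x, 'ag) fml \<Rightarrow> bool" where
  Taut: "tautology \<phi> \<Longrightarrow> axiom_inst \<phi>"
| Next_K: "axiom_inst (Next (\<phi> \<^bold>\<longrightarrow> \<psi>) \<^bold>\<longrightarrow> (Next \<phi> \<^bold>\<longrightarrow> Next \<psi>))"
| Always_K: "axiom_inst (Always (\<phi> \<^bold>\<longrightarrow> \<psi>) \<^bold>\<longrightarrow> (Always \<phi> \<^bold>\<longrightarrow> Always \<psi>))"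
| Next_fun: "axiom_inst (Next (Neg \<phi>) \<^bold>\<longleftrightarrow> Neg (Next \<phi>))"
| Always_ind: "axiom_inst (Always (\<phi> \<^bold>\<longrightarrow> Next \<phi>) \<^bold>\<longrightarrow> (\<phi> \<^bold>\<longrightarrow> Always \<phi>))"
| Until_ev: "axiom_inst ((\<phi> \<^bold>U \<psi>) \<^bold>\<longrightarrow> Eventually \<psi>)"
| Until_unfold: "axiom_inst ((\<phi> \<^bold>U \<psi>) \<^bold>\<longleftrightarrow> (\<psi> \<^bold>\<or> (\<phi> \<^bold>\<and> Next (\<phi> \<^bold>U \<psi>))))"
| Hist_K: "axiom_inst (Historically (\<phi> \<^bold>\<longrightarrow> \<psi>) \<^bold>\<longrightarrow> (Historically \<phi> \<^bold>\<longrightarrow> Historically \<psi>))"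
| WPrev_K: "axiom_inst (WPrev (\<phi> \<^bold>\<longrightarrow> \<psi>) \<^bold>\<longrightarrow> (WPrev \<phi> \<^bold>\<longrightarrow> WPrev \<psi>))"
| SPrev_WPrev: "axiom_inst (SPrev \<phi> \<^bold>\<longrightarrow> WPrev \<phi>)"
| Next_SPrev: "axiom_inst (\<phi> \<^bold>\<longrightarrow> Next (SPrev \<phi>))"
| WPrev_Next: "axiom_inst (\<phi> \<^bold>\<longrightarrow> WPrev (Next \<phi>))"
| Initial: "axiom_inst (Once (WPrev Fls))"
| Hist_ind: "axiom_inst (Historically (\<phi> \<^bold>\<longrightarrow> WPrev \<phi>) \<^bold>\<longrightarrow> (\<phi> \<^bold>\<longrightarrow> Historically \<phi>))"
| Since_once: "axiom_inst ((\<phi> \<^bold>S \<psi>) \<^bold>\<longrightarrow> Once \<psi>)"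
| Since_unfold: "axiom_inst ((\<phi> \<^bold>S \<psi>) \<^bold>\<longleftrightarrow> (\<psi> \<^bold>\<or> (\<phi> \<^bold>\<and> SPrev (\<phi> \<^bold>S \<psi>))))"
| Application: "axiom_inst (Just t i (\<phi> \<^bold>\<longrightarrow> \<psi>) \<^bold>\<longrightarrow> (Just s i \<phi> \<^bold>\<longrightarrow> Just (App t s) i \<psi>))"
| Sum_left: "axiom_inst (Just t i \<phi> \<^bold>\<longrightarrow> Just (Plus t s) i \<phi>)"
| Sum_right: "axiom_inst (Just s i \<phi> \<^bold>\<longrightarrow> Just (Plus t s) i \<phi>)"
| Factivity: "axiom_inst (Just t i \<phi> \<^bold>\<longrightarrow> \<phi>)"
| Introspection: "axiom_inst (Just t i \<phi> \<^bold>\<longrightarrow> Just (Bang t) i (Just t i \<phi>))"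

text \<open>\<open>const_chain [(c\<^sub>n, i\<^sub>n), \<dots>, (c\<^sub>1, i\<^sub>1)] \<phi>\<close> is \<open>[c\<^sub>n]\<^bsub>i\<^sub>n\<^esub> \<dots> [c\<^sub>1]\<^bsub>i\<^sub>1\<^esub> \<phi>\<close>.\<close>

fun const_chain :: "('c \<times> 'ag) list \<Rightarrow> ('p, 'c, 'x, 'ag) fml \<Rightarrow> ('p, 'c, 'x, 'ag) fml" where
  "const_chain [] \<phi> = \<phi>"
| "const_chain ((c, i) # cs) \<phi> = Just (Const c) i (const_chain cs \<phi>)"

definition constant_specification :: "('p, 'c, 'x, 'ag) fml set \<Rightarrow> bool" where
  "constant_specification CS \<longleftrightarrow>
     (\<forall>\<psi>\<in>CS. \<exists>cs \<phi>. cs \<noteq> [] \<and> axiom_inst \<phi> \<and> \<psi> = const_chain cs \<phi>) \<and>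
     (\<forall>c i cs \<phi>. cs \<noteq> [] \<and> axiom_inst \<phi> \<and> const_chain ((c, i) # cs) \<phi> \<in> CS
        \<longrightarrow> const_chain cs \<phi> \<in> CS)"

inductive derivable :: "('p, 'c, 'x, 'ag) fml set \<Rightarrow> ('p, 'c, 'x, 'ag) fml \<Rightarrow> bool"
  for CS :: "('p, 'c, 'x, 'ag) fml set" where
  Ax: "axiom_inst \<phi> \<Longrightarrow> derivable CS \<phi>"
| MP: "derivable CS (\<phi> \<^bold>\<longrightarrow> \<psi>) \<Longrightarrow> derivable CS \<phi> \<Longrightarrow> derivable CS \<psi>"
| Next_nec: "derivable CS \<phi> \<Longrightarrow> derivable CS (Next \<phi>)"
| WPrev_nec: "derivable CS \<phi> \<Longrightarrow> derivable CS (WPrev \<phi>)"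
| Always_nec: "derivable CS \<phi> \<Longrightarrow> derivable CS (Always \<phi>)"
| Hist_nec: "derivable CS \<phi> \<Longrightarrow> derivable CS (Historically \<phi>)"
| CS_nec: "\<psi> \<in> CS \<Longrightarrow> derivable CS \<psi>"

definition derivable_from ::
    "('p, 'c, 'x, 'ag) fml set \<Rightarrow> ('p, 'c, 'x, 'ag) fml set \<Rightarrow> ('p, 'c, 'x, 'ag) fml \<Rightarrow> bool" where
  "derivable_from CS \<Gamma> \<phi> \<longleftrightarrow> (\<exists>\<psi>s. set \<psi>s \<subseteq> \<Gamma> \<and> derivable CS (Conjs \<psi>s \<^bold>\<longrightarrow> \<phi>))"


section \<open>Interpreted systems\<close>

definition frame :: "'s set \<Rightarrow> ('ag \<Rightarrow> ('s \<times> 's) set) \<Rightarrow> bool" where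
  "frame S R \<longleftrightarrow> S \<noteq> {} \<and> (\<forall>i. R i \<subseteq> S \<times> S \<and> refl_on S (R i) \<and> trans (R i))"

definition evidence_function ::
    "('p, 'c, 'x, 'ag) fml set \<Rightarrow> 's set \<Rightarrow> ('s \<times> 's) set \<Rightarrow> 'ag
     \<Rightarrow> ('s \<Rightarrow> ('c, 'x) tm \<Rightarrow> ('p, 'c, 'x, 'ag) fml set) \<Rightarrow> bool" where
  "evidence_function CS S R i E \<longleftrightarrow>
     (\<forall>v\<in>S. \<forall>w\<in>S. \<forall>t. (v, w) \<in> R \<longrightarrow> E v t \<subseteq> E w t) \<and>
     (\<forall>w\<in>S. \<forall>t \<phi>. Just t i \<phi> \<in> CS \<longrightarrow> \<phi> \<in> E w t) \<and>
     (\<forall>w\<in>S. \<forall>s t \<phi> \<psi>. (\<phi> \<^bold>\<longrightarrow> \<psi>) \<in> E w t \<and> \<phi> \<in> E w s \<longrightarrow> \<psi> \<in> E w (App t s)) \<and>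
     (\<forall>w\<in>S. \<forall>s t. E w s \<union> E w t \<subseteq> E w (Plus s t)) \<and>
     (\<forall>w\<in>S. \<forall>t \<phi>. \<phi> \<in> E w t \<longrightarrow> Just t i \<phi> \<in> E w (Bang t))"

record ('p, 'c, 'x, 'ag, 's) isys =
  runs :: "(nat \<Rightarrow> 's) set"
  states :: "'s set"
  acc :: "'ag \<Rightarrow> ('s \<times> 's) set"
  evid :: "'ag \<Rightarrow> 's \<Rightarrow> ('c, 'x) tm \<Rightarrow> ('p, 'c, 'x, 'ag) fml set"
  val :: "'s \<Rightarrow> 'p set"

definition interpreted_system ::
    "('p, 'c, 'x, 'ag) fml set \<Rightarrow> ('p, 'c, 'x, 'ag, 's) isys \<Rightarrow> bool" where
  "interpreted_system CS I \<longleftrightarrow>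
     frame (states I) (acc I) \<and>
     runs I \<noteq> {} \<and> (\<forall>r\<in>runs I. \<forall>n. r n \<in> states I) \<and>
     (\<forall>i. evidence_function CS (states I) (acc I i) i (evid I i))"

fun holds ::
    "('p, 'c, 'x, 'ag, 's) isys \<Rightarrow> (nat \<Rightarrow> 's) \<Rightarrow> nat \<Rightarrow> ('p, 'c, 'x, 'ag) fml \<Rightarrow> bool" where
  "holds I r n (Atom p) \<longleftrightarrow> p \<in> val I (r n)"
| "holds I r n Fls \<longleftrightarrow> False"
| "holds I r n (\<phi> \<^bold>\<longrightarrow> \<psi>) \<longleftrightarrow> (holds I r n \<phi> \<longrightarrow> holds I r n \<psi>)"
| "holds I r n (WPrev \<phi>) \<longleftrightarrow> n = 0 \<or> holds I r (n - 1) \<phi>"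
| "holds I r n (Next \<phi>) \<longleftrightarrow> holds I r (n + 1) \<phi>"
| "holds I r n (\<phi> \<^bold>S \<psi>) \<longleftrightarrow>
     (\<exists>m\<le>n. holds I r m \<psi> \<and> (\<forall>k. m < k \<and> k \<le> n \<longrightarrow> holds I r k \<phi>))"
| "holds I r n (\<phi> \<^bold>U \<psi>) \<longleftrightarrow>
     (\<exists>m\<ge>n. holds I r m \<psi> \<and> (\<forall>k. n \<le> k \<and> k < m \<longrightarrow> holds I r k \<phi>))"
| "holds I r n (Just t i \<phi>) \<longleftrightarrow>
     \<phi> \<in> evid I i (r n) t \<and>
     (\<forall>r'\<in>runs I. \<forall>n'. (r n, r' n') \<in> acc I i \<longrightarrow> holds I r' n' \<phi>)"

text \<open>
  HOL cannot quantify over state sets of all types inside a formula, so consequence carries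
  the ambient type \<open>'s\<close> of states as a parameter; the states of a system form an arbitrary nonempty
  set over \<open>'s\<close>. A theorem in which \<open>'s\<close> is a free type variable speaks about all systems.
\<close>

definition consequence ::
    "'s itself \<Rightarrow> ('p, 'c, 'x, 'ag) fml set \<Rightarrow> ('p, 'c, 'x, 'ag) fml set
     \<Rightarrow> ('p, 'c, 'x, 'ag) fml \<Rightarrow> bool" where
  "consequence T CS \<Gamma> \<phi> \<longleftrightarrow>
     (\<forall>I :: ('p, 'c, 'x, 'ag, 's) isys. interpreted_system CS I \<longrightarrow>
       (\<forall>r\<in>runs I. \<forall>n. (\<forall>\<psi>\<in>\<Gamma>. holds I r n \<psi>) \<longrightarrow> holds I r n \<phi>))"

end

theory Submission
  imports Defs
begin

text \<open>Soundness: by induction on derivations, every derivable formula is true at every point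
  of every interpreted system (\<open>derivable_sound\<close>). The temporal axioms hold because
  time is \<open>nat\<close> with a least point; their induction axioms are induction along a run.
  The justification axioms mirror the closure conditions on evidence functions, with reflexivity
  giving factivity and transitivity giving introspection (\<open>axiom_inst_sound\<close>). Formulas
  of \<open>CS\<close> reduce to axioms by peeling off constants
  (\<open>constant_specification_sound\<close>). Consequence from \<Gamma> then amounts to modus
  ponens at a single point.\<close>

lemma holds_Until_unfold:
  "holds I r n (\<phi> \<^bold>U \<psi>) \<longleftrightarrow>
     holds I r n \<psi> \<or> holds I r n \<phi> \<and> holds I r (Suc n) (\<phi> \<^bold>U \<psi>)" (is "?U \<longleftrightarrow> ?V")
proof
  assume ?U
  then obtain m where m: "m \<ge> n" "holds I r m \<psi>" "\<And>k. n \<le> k \<Longrightarrow> k < m \<Longrightarrow> holds I r k \<phi>"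
    by auto
  show ?V
  proof (cases "m = n")
    case False
    with m(1) have "Suc n \<le> m" by simp
    with m show ?thesis by (auto intro!: exI[of _ m])
  qed (use m in simp)
next
  assume ?V
  then show ?U
  proof
    assume "holds I r n \<phi> \<and> holds I r (Suc n) (\<phi> \<^bold>U \<psi>)"
    then obtain m where m: "m \<ge> Suc n" "holds I r m \<psi>" "holds I r n \<phi>"
        "\<And>k. Suc n \<le> k \<Longrightarrow> k < m \<Longrightarrow> holds I r k \<phi>"
      by auto
    then have "holds I r k \<phi>" if "n \<le> k" "k < m" for k
      using that by (cases "k = n") auto
    with m(1,2) show ?U by (auto intro!: exI[of _ m])
  qed auto
qed

text \<open>A witness \<open>m\<close> is either \<open>n\<close> itself or also serves at
  \<open>n - 1\<close>. The conjunct \<open>n > 0\<close> reflects the strong previous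
  \<open>SPrev\<close>, which fails at time 0, and guards the truncated subtraction.\<close>

lemma holds_Since_unfold:
  "holds I r n (\<phi> \<^bold>S \<psi>) \<longleftrightarrow>
     holds I r n \<psi> \<or> holds I r n \<phi> \<and> n > 0 \<and> holds I r (n - 1) (\<phi> \<^bold>S \<psi>)" (is "?S \<longleftrightarrow> ?V")
proof
  assume ?S
  then obtain m where m: "m \<le> n" "holds I r m \<psi>" "\<And>k. m < k \<Longrightarrow> k \<le> n \<Longrightarrow> holds I r k \<phi>"
    by auto
  show ?V
  proof (cases "m = n")
    case False
    with m(1) have "m \<le> n - 1" "n > 0" by simp_all
    with m show ?thesis by (auto intro!: exI[of _ m])
  qed (use m in simp)
next
  assume ?V
  then show ?S
  proof
    assume "holds I r n \<phi> \<and> n > 0 \<and> holds I r (n - 1) (\<phi> \<^bold>S \<psi>)"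
    then obtain m where m: "m \<le> n - 1" "holds I r m \<psi>" "holds I r n \<phi>"
        "\<And>k. m < k \<Longrightarrow> k \<le> n - 1 \<Longrightarrow> holds I r k \<phi>"
      by auto
    then have "holds I r k \<phi>" if "m < k" "k \<le> n" for k
      using that by (cases "k = n") auto
    with m(1,2) show ?S by (auto intro!: exI[of _ m])
  qed auto
qed

text \<open>Truth at a point is itself one of the valuations over which \<open>tautology\<close>
  quantifies.\<close>

lemma peval_holds: "peval (holds I r n) \<phi> \<longleftrightarrow> holds I r n \<phi>"
  by (induction "holds I r n" \<phi> rule: peval.induct) simp_all

lemma axiom_inst_sound:
  assumes I: "interpreted_system CS I" and r: "r \<in> runs I" and "axiom_inst \<phi>"
  shows "holds I r n \<phi>"
  using assms(3)
proof cases
  case Taut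
  then show ?thesis
    using peval_holds[of I r n \<phi>] by (simp add: tautology_def)
next
  case (Always_ind \<psi>)
  have "holds I r m \<psi>"
    if "\<And>k. n \<le> k \<Longrightarrow> holds I r k \<psi> \<Longrightarrow> holds I r (k + 1) \<psi>"
      and "holds I r n \<psi>" "n \<le> m" for m
    using that(3,2)
  proof (induction m rule: dec_induct)
    case (step k)
    then show ?case using that(1)[of k] by simp
  qed
  then show ?thesis
    unfolding Always_ind holds.simps by blast
next
  case (Hist_ind \<psi>)
  \<comment> \<open>Induction backwards in time from \<open>n\<close> down to \<open>m\<close>. The
    premise is used at \<open>Suc k\<close>, where the escape clause \<open>k = 0\<close> of weak
    previous is impossible.\<close>
  have "holds I r m \<psi>"
    if "\<And>k. k \<le> n \<Longrightarrow> holds I r k \<psi> \<Longrightarrow> k = 0 \<or> holds I r (k - 1) \<psi>"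
      and "holds I r n \<psi>" "m \<le> n" for m
    using that(3,2)
  proof (induction m rule: inc_induct)
    case (step k)
    then show ?case using that(1)[of "Suc k"] by simp
  qed
  then show ?thesis
    unfolding Hist_ind holds.simps by blast
next
  case (Until_unfold \<psi> \<chi>)
  show ?thesis
    unfolding Until_unfold using holds_Until_unfold[of I r n \<psi> \<chi>]
    \<comment> \<open>The clauses for since and until stay folded so that the unfolding equivalence
      still matches.\<close>
    by (simp del: holds.simps(6,7)) blast
next
  case (Since_unfold \<psi> \<chi>)
  show ?thesis
    unfolding Since_unfold using holds_Since_unfold[of I r n \<psi> \<chi>]
    by (auto simp del: holds.simps(6,7))
next
  case (Application t i \<psi> \<chi> s)
  then show ?thesis
    using I r unfolding interpreted_system_def evidence_function_def by simp blast
next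
  case (Sum_left t i \<psi> s)
  then show ?thesis
    using I r unfolding interpreted_system_def evidence_function_def by simp blast
next
  case (Sum_right s i \<psi> t)
  then show ?thesis
    using I r unfolding interpreted_system_def evidence_function_def by simp blast
next
  case (Factivity t i \<psi>)
  have "(r n, r n) \<in> acc I i"
    using I r unfolding interpreted_system_def frame_def refl_on_def by blast
  then show ?thesis
    using Factivity r by auto
next
  case (Introspection t i \<psi>)
  have tr: "trans (acc I i)"
    and st: "\<And>r' m. r' \<in> runs I \<Longrightarrow> r' m \<in> states I"
    and ev: "evidence_function CS (states I) (acc I i) i (evid I i)"
    using I by (simp_all add: interpreted_system_def frame_def)
  have mono: "\<psi> \<in> evid I i w t"
    if "(v, w) \<in> acc I i" "v \<in> states I" "w \<in> states I" "\<psi> \<in> evid I i v t" for v w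
    using ev that unfolding evidence_function_def by blast
  have bang: "Just t i \<psi> \<in> evid I i w (Bang t)"
    if "w \<in> states I" "\<psi> \<in> evid I i w t" for w
    using ev that unfolding evidence_function_def by blast
  have "holds I r n (Just (Bang t) i (Just t i \<psi>))" if J: "holds I r n (Just t i \<psi>)"
  proof -
    \<comment> \<open>Evidence moves to \<open>r' m\<close> by monotonicity; by transitivity,
      whatever is accessible from \<open>r' m\<close> is already accessible from
      \<open>r n\<close>.\<close>
    have "holds I r' m (Just t i \<psi>)" if "r' \<in> runs I" "(r n, r' m) \<in> acc I i" for r' m
      using J that r st mono[of "r n" "r' m"] transD[OF tr that(2)] by auto
    then show ?thesis
      using J r bang[of "r n"] st[of r n] by simp
  qed
  then show ?thesis
    unfolding Introspection holds.simps(3) by blast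
next
  case Initial
  show ?thesis
    \<comment> \<open>The past witness is time 0, where every \<open>WPrev\<close> formula is
      vacuously true.\<close>
    unfolding Initial holds.simps using le0[of n] by blast
next
  case (Always_K \<phi> \<psi>)
  show ?thesis unfolding Always_K holds.simps by blast
next
  case (Hist_K \<phi> \<psi>)
  show ?thesis unfolding Hist_K holds.simps by blast
next
  case (WPrev_Next \<psi>)
  then show ?thesis by (cases n) auto
qed auto

text \<open>Induction on the chain of constants: evidence for the outermost one comes from the
  \<open>CS\<close> clause of \<open>evidence_function\<close>. The inner formula is needed at all
  accessible points, possibly on other runs, so run and time are generalised. The disjunct
  \<open>cs = []\<close> covers the bare axiom, which need not lie in \<open>CS\<close>.\<close>

lemma constant_specification_sound:
  assumes CS: "constant_specification CS" and I: "interpreted_system CS I"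
    and "r \<in> runs I" and "\<psi> \<in> CS"
  shows "holds I r n \<psi>"
proof -
  obtain cs \<phi> where \<phi>: "axiom_inst \<phi>" and "\<psi> = const_chain cs \<phi>"
    using CS \<open>\<psi> \<in> CS\<close> unfolding constant_specification_def by blast
  \<comment> \<open>Downward closure of \<open>CS\<close> is what lets the induction descend to the shorter chain.\<close>
  have "const_chain cs \<phi> \<in> CS \<or> cs = [] \<Longrightarrow> r \<in> runs I \<Longrightarrow> holds I r n (const_chain cs \<phi>)"
    for r n
  proof (induction cs arbitrary: r n)
    case Nil
    then show ?case using axiom_inst_sound[OF I _ \<phi>] by simp
  next
    case (Cons ci cs)
    obtain c i where ci: "ci = (c, i)" by (cases ci)
    have in_CS: "const_chain ((c, i) # cs) \<phi> \<in> CS" using Cons.prems ci by simp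
    then have "const_chain cs \<phi> \<in> CS \<or> cs = []"
      using CS \<phi> unfolding constant_specification_def by blast
    moreover have "const_chain cs \<phi> \<in> evid I i (r n) (Const c)"
      using I in_CS Cons.prems(2) unfolding interpreted_system_def evidence_function_def by simp
    ultimately show ?case
      using Cons.IH by (simp add: ci)
  qed
  then show ?thesis
    using assms \<open>\<psi> = const_chain cs \<phi>\<close> by blast
qed

text \<open>The time \<open>n\<close> must be arbitrary because the necessitation rules shift it;
  the run can stay fixed, since temporal operators never leave it.\<close>

lemma derivable_sound:
  assumes "constant_specification CS" and "interpreted_system CS I"
    and "derivable CS \<phi>" and "r \<in> runs I"
  shows "holds I r n \<phi>"
  using assms(3)
proof (induction arbitrary: n)
  case (Ax \<phi>)
  then show ?case using axiom_inst_sound assms(2,4) by blast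
next
  case (CS_nec \<psi>)
  then show ?case using constant_specification_sound assms(1,2,4) by blast
qed auto

lemma holds_Conjs: "holds I r n (Conjs \<psi>s) \<longleftrightarrow> (\<forall>\<psi>\<in>set \<psi>s. holds I r n \<psi>)"
  by (induction \<psi>s rule: Conjs.induct) auto

theorem theorem1:
  fixes CS :: "('p::countable, 'c::countable, 'x::countable, 'ag::finite) fml set"
    and \<Gamma> :: "('p, 'c, 'x, 'ag) fml set"
    and \<phi> :: "('p, 'c, 'x, 'ag) fml"
  assumes "constant_specification CS"
    and "finite \<Gamma>"
    and "derivable_from CS \<Gamma> \<phi>"
  shows "consequence TYPE('s) CS \<Gamma> \<phi>"
  unfolding consequence_def
proof (intro allI impI ballI)
  fix I :: "('p, 'c, 'x, 'ag, 's) isys" and r n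
  assume I: "interpreted_system CS I" "r \<in> runs I" and \<Gamma>: "\<forall>\<psi>\<in>\<Gamma>. holds I r n \<psi>"
  obtain \<psi>s where "set \<psi>s \<subseteq> \<Gamma>" "derivable CS (Conjs \<psi>s \<^bold>\<longrightarrow> \<phi>)"
    using assms(3) unfolding derivable_from_def by blast
  moreover from this(1) \<Gamma> have "holds I r n (Conjs \<psi>s)"
    by (auto simp: holds_Conjs)
  \<comment> \<open>The derivable implication is true at every point, in particular at
    \<open>n\<close> on \<open>r\<close>.\<close>
  ultimately show "holds I r n \<phi>"
    using derivable_sound[OF assms(1) I(1) _ I(2)] holds.simps(3) by blast
qed

end
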